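(* Let $f:\mathbb N_0^2\to\mathbb C$ and $r>0$. The following conditions are equivalent: (1) the function $f$ is positive semidefinite and there exists a number $C>0$ such that $f(n,n)\le Cr^{2n}$ for all $n\in\mathbb N$; (2) there is a positive Radon measure $\mu$ on $K=\{z\in\mathbb C:|z|^2\le r^2\}$ such that $$f(m,n)=\int_K z^n\bar z^m\,d\mu(z)\quad\text{for all }(m,n)\in\mathbb N_0^2.$$
   Context: $\mathbb N=\{1,2,\dots\}$, $\mathbb N_0=\mathbb N\cup\{0\}$. $\mathbb N_0^2$ is regarded as a commutative semigroup with involution via $(m,n)\cdot(p,q)=(m+p,n+q)$, neutral element $(0,0)$, and $(m,n)^*=(n,m)$. A function $f$ on a commutative semigroup $S$ with involution is positive semidefinite if $\sum_{j,k=1}^N c_j\overline{c_k}f(s_j^*s_k)\ge 0$ for all $N\in\mathbb N$, $s_1,\dots,s_N\in S$, $c_1,\dots,c_N\in\mathbb C$. *)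

theory Defs
  imports "HOL-Analysis.Analysis" "HOL-Library.Complex_Order"
begin

locale comm_involution_semigroup = abel_semigroup mult
  for mult :: "'a \<Rightarrow> 'a \<Rightarrow> 'a" (infixl \<open>\<cdot>\<close> 70)
  and star :: "'a \<Rightarrow> 'a" +
  assumes star_star: "star (star s) = s"
    and star_mult: "star (s \<cdot> t) = star t \<cdot> star s"
begin

(* The order on complex numbers is the one of Complex_Order: 0 \<le> z means that z is real
   and nonnegative. *)
definition positive_semidefinite :: "('a \<Rightarrow> complex) \<Rightarrow> bool" where
  "positive_semidefinite f \<longleftrightarrow>
    (\<forall>N\<ge>1. \<forall>(s :: nat \<Rightarrow> 'a) (c :: nat \<Rightarrow> complex).
      0 \<le> (\<Sum>j=1..N. \<Sum>k=1..N. c j * cnj (c k) * f (star (s j) \<cdot> s k)))"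

end

(* The semigroup of pairs of naturals with componentwise addition and (m, n)* = (n, m). *)
global_interpretation nat_pairs: comm_involution_semigroup
  "(+) :: nat \<times> nat \<Rightarrow> nat \<times> nat \<Rightarrow> nat \<times> nat" prod.swap
  by unfold_locales (auto simp: prod.swap_def)

(* A positive Radon measure on the subspace K: a Borel measure on K that is finite on compact
   sets and inner regular with respect to compact sets. The underlying space of the
   measure is K itself. *)
definition radon_measure_on :: "'a::t2_space set \<Rightarrow> 'a measure \<Rightarrow> bool" where
  "radon_measure_on K \<mu> \<longleftrightarrow>
    sets \<mu> = sets (restrict_space borel K) \<and>
    (\<forall>L. compact L \<and> L \<subseteq> K \<longrightarrow> emeasure \<mu> L < \<infinity>) \<and>
    (\<forall>B \<in> sets \<mu>. emeasure \<mu> B = (SUP L \<in> {L. compact L \<and> L \<subseteq> B}. emeasure \<mu> L))"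

end

theory Submission
  imports Defs "HOL-Probability.Probability"
begin

text \<open>If \<open>f\<close> is the moment function of a measure on the disc, its quadratic form is the integral of
\<open>|p(z)|^2\<close> for a polynomial \<open>p\<close> in \<open>z\<close> and \<open>cnj z\<close>, and \<open>f (n, n)\<close> is the integral of
\<open>|z|^(2n) \<le> r^(2n)\<close>. The work is in the other direction.

Read \<open>f\<close> as the linear functional \<open>L\<close> with \<open>L (z^n * (cnj z)^m) = f (m, n)\<close>. Positive
semidefiniteness says \<open>L (|p|^2) \<ge> 0\<close> for all polynomials \<open>p\<close>. The growth condition strengthens this to
\<open>L ((r^2 - |z|^2) * |p|^2) \<ge> 0\<close>: the sequence \<open>L (|z|^(2k) * |p|^2)\<close> is log-convex and is
\<open>O(r^(2k))\<close>, so its first ratio is at most \<open>r^2\<close> (lemma \<open>psd_growth_localized\<close>).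

For \<open>z = x + \<i> * y\<close> one has \<open>2 * r * (r + x) = |r + z|^2 + (r^2 - |z|^2)\<close>, and similarly for
\<open>r - x\<close>, \<open>r + y\<close> and \<open>r - y\<close>. Hence multiplying \<open>L\<close> by one of these four functions gives again a
positive semidefinite functional, and it satisfies a growth condition of the same kind
(lemma \<open>psd_growth_half_plane_times\<close>). By iteration,
\<open>L ((r + x)^i * (r - x)^k * (r + y)^j * (r - y)^l) \<ge> 0\<close> for all exponents. After rescaling, these are the
conditions of the Hausdorff moment problem on the unit square, whose solution
(theorem \<open>hausdorff_moment_problem_square\<close>) provides a measure on the square circumscribed about the
disc with the moments of \<open>f\<close> (lemma \<open>psd_growth_moments_on_square\<close>). Finally,
\<open>\<integral>|z|^(2n) = f (n, n) = O(r^(2n))\<close> shows that this measure lives on the disc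
(lemma \<open>disc_measure_if_psd_growth\<close>).

The Hausdorff problem is solved by a weak limit of discrete measures on grids. The limit is obtained
from Helly's selection theorem on the real line by lifting the atoms along a space-filling curve of
Schoenberg (lemma \<open>discrete_measures_on_square_convergent_subsequence\<close>).\<close>

section \<open>Schoenberg's space-filling curve\<close>

text \<open>An even function of period \<open>2\<close> that is constantly \<open>0\<close> on \<open>[0, 1/3]\<close> and constantly \<open>1\<close> on
\<open>[2/3, 1]\<close>. Schoenberg's curve is usually built from a piecewise linear wave with these
properties; clipping a cosine gives periodicity and continuity for free.\<close>

definition schoenberg_wave :: "real \<Rightarrow> real" where
  "schoenberg_wave t = max 0 (min 1 (1/2 - cos (pi * t)))"

text \<open>If all ternary digits of \<open>t\<close> are \<open>0\<close> or \<open>2\<close>, the wave at \<open>3 ^ m * t\<close> reads off half of the digit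
in position \<open>m\<close>, counted from \<open>0\<close>. The first coordinate (\<open>b = 0\<close>) reassembles the digits in even
positions into a binary number, the second (\<open>b = 1\<close>) those in odd positions.\<close>

definition schoenberg_coord :: "nat \<Rightarrow> real \<Rightarrow> real" where
  "schoenberg_coord b t = (\<Sum>k. schoenberg_wave (3 ^ (2 * k + b) * t) / 2 ^ (k + 1))"

definition schoenberg_curve :: "real \<Rightarrow> real \<times> real" where
  "schoenberg_curve t = (schoenberg_coord 0 t, schoenberg_coord 1 t)"

lemma schoenberg_wave_range: "0 \<le> schoenberg_wave t" "schoenberg_wave t \<le> 1"
  by (auto simp: schoenberg_wave_def)

lemma sums_half_powers: "(\<lambda>k. 1 / 2 ^ (k + 1) :: real) sums 1"
  using power_half_series by (simp add: power_one_over)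

lemma summable_schoenberg: "summable (\<lambda>k. schoenberg_wave (3 ^ (2 * k + b) * t) / 2 ^ (k + 1))"
  by (rule summable_comparison_test'[OF sums_summable[OF sums_half_powers], of 0])
     (use schoenberg_wave_range in \<open>auto simp: divide_right_mono\<close>)

lemma schoenberg_coord_range: "0 \<le> schoenberg_coord b t" "schoenberg_coord b t \<le> 1"
proof -
  show "0 \<le> schoenberg_coord b t"
    unfolding schoenberg_coord_def
    by (rule suminf_nonneg[OF summable_schoenberg]) (simp add: schoenberg_wave_range)
  have "schoenberg_coord b t \<le> (\<Sum>k. 1 / 2 ^ (k + 1))"
    unfolding schoenberg_coord_def
    by (rule suminf_le[OF _ summable_schoenberg sums_summable[OF sums_half_powers]])
       (simp add: schoenberg_wave_range divide_right_mono)
  then show "schoenberg_coord b t \<le> 1"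
    using sums_half_powers by (simp add: sums_iff)
qed

lemma continuous_schoenberg_coord: "continuous_on UNIV (schoenberg_coord b)"
proof -
  have unif: "uniform_limit UNIV
      (\<lambda>n t. \<Sum>k<n. schoenberg_wave (3 ^ (2 * k + b) * t) / 2 ^ (k + 1))
      (schoenberg_coord b) sequentially"
    unfolding schoenberg_coord_def
    by (rule Weierstrass_m_test[OF _ sums_summable[OF sums_half_powers]])
       (use schoenberg_wave_range in \<open>auto simp: divide_right_mono\<close>)
  show ?thesis
    by (rule uniform_limit_theorem[OF _ unif])
       (auto simp: schoenberg_wave_def intro!: always_eventually continuous_intros)
qed

text \<open>The even integer \<open>2 * m\<close> is removed by periodicity, and the remainder lies in a plateau of the wave.\<close>

lemma schoenberg_wave_digit:
  fixes m :: nat and s :: real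
  assumes a: "a = 0 \<or> a = (1::nat)" and s: "0 \<le> s" "s \<le> 1/3"
  shows "schoenberg_wave (2 * real m + 2 * real a / 3 + s) = real a"
proof -
  have per: "cos (pi * (2 * real m + x)) = cos (pi * x)" for x
    using cos.plus_of_nat[of "pi * x" m] by (simp add: algebra_simps)
  show ?thesis
  proof (cases "a = 0")
    case True
    have "cos (pi / 3) \<le> cos (pi * s)"
      using s by (intro cos_monotone_0_pi_le) auto
    then show ?thesis
      using True per[of s] by (simp add: schoenberg_wave_def cos_60)
  next
    case False
    then have a1: "a = 1" using a by auto
    have "pi * (2/3 + s) \<le> pi * 1"
      using s by (intro mult_left_mono) auto
    then have "cos (pi * (2/3 + s)) \<le> cos (2 / 3 * pi)"
      using s by (intro cos_monotone_0_pi_le) (auto simp: algebra_simps)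
    then have "cos (pi * (2 * real m + (2/3 + s))) \<le> - 1/2"
      using per[of "2/3 + s"] by (simp add: cos_120)
    moreover have "2 * real m + 2 * real a / 3 + s = 2 * real m + (2/3 + s)"
      using a1 by simp
    ultimately show ?thesis
      using a1 by (simp only: schoenberg_wave_def)
  qed
qed

text \<open>The greedy algorithm: after each digit the remainder is doubled and stays in \<open>[0, 1]\<close>. The endpoint
\<open>x = 1\<close> is covered by the expansion with all digits equal to \<open>1\<close>.\<close>

lemma binary_expansion:
  fixes x :: real
  assumes "0 \<le> x" "x \<le> 1"
  shows "\<exists>a :: nat \<Rightarrow> nat. (\<forall>k. a k = 0 \<or> a k = 1) \<and> (\<lambda>k. real (a k) / 2 ^ (k + 1)) sums x"
proof -
  define R where "R = rec_nat x (\<lambda>_ y :: real. if y \<ge> 1/2 then 2 * y - 1 else 2 * y)"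
  define a where "a k = (if R k \<ge> 1/2 then 1 else 0 :: nat)" for k
  have R: "R 0 = x" "R (Suc k) = 2 * R k - real (a k)" for k
    by (auto simp: R_def a_def)
  have range: "0 \<le> R k \<and> R k \<le> 1" for k
    by (induction k) (use assms in \<open>auto simp: R a_def\<close>)
  have partial: "(\<Sum>k<n. real (a k) / 2 ^ (k + 1)) = x - R n / 2 ^ n" for n
    by (induction n) (auto simp: R field_simps)
  have "(\<lambda>n. R n / 2 ^ n) \<longlonglongrightarrow> 0"
  proof (rule Lim_null_comparison[of _ "\<lambda>n. (1/2::real) ^ n"])
    show "\<forall>\<^sub>F n in sequentially. norm (R n / 2 ^ n) \<le> (1/2) ^ n"
      using range by (auto simp: power_one_over divide_right_mono)
  qed (simp add: LIMSEQ_power_zero)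
  then have "(\<lambda>n. x - R n / 2 ^ n) \<longlonglongrightarrow> x - 0"
    by (intro tendsto_intros)
  then have "(\<lambda>k. real (a k) / 2 ^ (k + 1)) sums x"
    unfolding sums_def partial by simp
  then show ?thesis
    by (intro exI[of _ a]) (auto simp: a_def)
qed

text \<open>Interleave the binary digits of the two coordinates, and use the doubled digits as the ternary
expansion of the parameter.\<close>

lemma schoenberg_curve_surj:
  assumes "0 \<le> x" "x \<le> 1" "0 \<le> y" "y \<le> 1"
  shows "\<exists>t\<in>{0..1}. schoenberg_curve t = (x, y)"
proof -
  obtain a where a: "\<And>k. a k = 0 \<or> a k = (1::nat)" "(\<lambda>k. real (a k) / 2 ^ (k + 1)) sums x"
    using binary_expansion[of x] assms by auto
  obtain b where b: "\<And>k. b k = 0 \<or> b k = (1::nat)" "(\<lambda>k. real (b k) / 2 ^ (k + 1)) sums y"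
    using binary_expansion[of y] assms by auto
  define c where "c n = (if even n then a (n div 2) else b (n div 2))" for n
  have c01: "c n = 0 \<or> c n = 1" for n
    using a(1) b(1) by (auto simp: c_def)
  define u where "u i = 2 * real (c i) / 3 ^ (i + 1)" for i
  have geo: "(\<lambda>i. 2 / 3 ^ (i + 1) :: real) sums 1"
    using sums_mult[OF geometric_sums[of "1/3::real"], of "2/3"] by (simp add: power_one_over)
  have u0: "0 \<le> u i" and ule: "u i \<le> 2 / 3 ^ (i + 1)" for i
    using c01[of i] by (auto simp: u_def)
  have su: "summable u"
    by (rule summable_comparison_test'[OF sums_summable[OF geo], of 0]) (use u0 ule in auto)
  define t where "t = suminf u"
  have t: "t \<in> {0..1}"
    using suminf_nonneg[OF su] u0 suminf_le[OF ule su sums_summable[OF geo]] geo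
    by (auto simp: t_def sums_iff)
  have digit: "schoenberg_wave (3 ^ m * t) = real (c m)" for m
  proof -
    \<comment> \<open>The digits before position \<open>m\<close> contribute an even integer to \<open>3 ^ m * t\<close>,
        the digits after it at most \<open>1/3\<close>.\<close>
    define e where "e = (\<Sum>i<m. c i * 3 ^ (m - Suc i))"
    define s where "s = 3 ^ m * (\<Sum>i. u (i + Suc m))"
    have "2 * real e = 3 ^ m * (\<Sum>i<m. u i)"
    proof -
      have "2 * (real (c i) * 3 ^ (m - Suc i)) = 3 ^ m * u i" if "i < m" for i
      proof -
        have "(3::real) ^ m = 3 ^ (m - Suc i) * 3 ^ (i + 1)"
          using that by (subst power_add[symmetric]) simp
        then show ?thesis by (simp add: u_def)
      qed
      then show ?thesis
        unfolding e_def of_nat_sum sum_distrib_left by (intro sum.cong) auto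
    qed
    moreover have "t = (\<Sum>i. u (i + Suc m)) + (\<Sum>i<m. u i) + u m"
      unfolding t_def using suminf_split_initial_segment[OF su, of "Suc m"] by simp
    ultimately have eq: "3 ^ m * t = 2 * real e + 2 * real (c m) / 3 + s"
      by (simp add: s_def u_def algebra_simps)
    have su': "summable (\<lambda>i. u (i + Suc m))"
      using su by (rule summable_ignore_initial_segment)
    have geo': "(\<lambda>i. 2 / 3 ^ (i + Suc m + 1) :: real) sums (1 / 3 ^ Suc m)"
      using sums_mult[OF geo, of "1 / 3 ^ Suc m"] by (simp add: power_add field_simps)
    have "(\<Sum>i. u (i + Suc m)) \<le> 1 / 3 ^ Suc m"
      using suminf_le[OF ule su' sums_summable[OF geo']] geo' by (simp add: sums_iff)
    then have "s \<le> 3 ^ m * (1 / 3 ^ Suc m)"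
      unfolding s_def by (intro mult_left_mono) auto
    then have "s \<le> 1/3" by simp
    moreover have "0 \<le> s"
      unfolding s_def using suminf_nonneg[OF su'] u0 by simp
    ultimately show ?thesis
      unfolding eq using c01 by (intro schoenberg_wave_digit)
  qed
  have "schoenberg_coord 0 t = x" "schoenberg_coord 1 t = y"
    unfolding schoenberg_coord_def digit using a(2) b(2) by (auto simp: c_def sums_iff)
  with t show ?thesis
    by (auto simp: schoenberg_curve_def)
qed

section \<open>Compactness of discrete measures on the unit square\<close>

text \<open>A surjection from the line onto the square reduces compactness of plane measures to Helly's
theorem on the line: the atoms are lifted along the curve, a weak limit is taken there, and the
limit is pushed forward. A continuous test function on the square becomes a bounded continuous
one on the line after composition with the curve. Because the measures are discrete, any choice of
preimages of the atoms will do, so that no measurable right inverse of the curve has to be found.\<close>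

lemma discrete_measures_on_square_convergent_subsequence:
  fixes A :: "nat \<Rightarrow> 'i set" and w :: "nat \<Rightarrow> 'i \<Rightarrow> real" and pt :: "nat \<Rightarrow> 'i \<Rightarrow> real \<times> real"
  assumes fin: "\<And>n. finite (A n)"
    and nonneg: "\<And>n i. i \<in> A n \<Longrightarrow> 0 \<le> w n i"
    and mass: "\<And>n. (\<Sum>i\<in>A n. w n i) = 1"
    and square: "\<And>n i. i \<in> A n \<Longrightarrow> pt n i \<in> {0..1} \<times> {0..1}"
  shows "\<exists>(M :: (real \<times> real) measure) s. prob_space M \<and> sets M = sets borel \<and> strict_mono s \<and>
    (AE p in M. p \<in> {0..1} \<times> {0..1}) \<and>
    (\<forall>g :: real \<times> real \<Rightarrow> real. continuous_on UNIV g \<longrightarrow>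
      (\<lambda>n. \<Sum>i\<in>A (s n). w (s n) i * g (pt (s n) i)) \<longlonglongrightarrow> (\<integral>p. g p \<partial>M))"
proof -
  have "\<forall>n i. \<exists>\<tau>. i \<in> A n \<longrightarrow> \<tau> \<in> {0..1} \<and> schoenberg_curve \<tau> = pt n i"
  proof (intro allI)
    fix n i
    show "\<exists>\<tau>. i \<in> A n \<longrightarrow> \<tau> \<in> {0..1} \<and> schoenberg_curve \<tau> = pt n i"
      using schoenberg_curve_surj[of "fst (pt n i)" "snd (pt n i)"] square[of i n] by force
  qed
  then obtain \<tau> where \<tau>: "\<And>n i. i \<in> A n \<Longrightarrow> \<tau> n i \<in> {0..1}"
      "\<And>n i. i \<in> A n \<Longrightarrow> schoenberg_curve (\<tau> n i) = pt n i"
    by metis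
  define W where "W n i = (if i \<in> A n then w n i else 0)" for n i
  define P where "P n = embed_pmf (W n)" for n
  have W0: "0 \<le> W n i" for n i
    using nonneg by (auto simp: W_def)
  have pmf_P: "pmf (P n) i = W n i" for n i
    unfolding P_def
  proof (rule pmf_embed_pmf)
    have "(\<integral>\<^sup>+i. ennreal (W n i) \<partial>count_space UNIV) = (\<Sum>i\<in>A n. ennreal (W n i))"
      by (rule nn_integral_count_space') (use fin in \<open>auto simp: W_def\<close>)
    also have "\<dots> = ennreal (\<Sum>i\<in>A n. w n i)"
      by (subst sum_ennreal[symmetric]) (auto simp: W_def nonneg intro!: sum.cong)
    finally show "(\<integral>\<^sup>+i. ennreal (W n i) \<partial>count_space UNIV) = 1"
      using mass by simp
  qed (rule W0)
  have set_P: "set_pmf (P n) \<subseteq> A n" for n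
    by (auto simp: set_pmf_eq pmf_P W_def)
  define \<nu> where "\<nu> n = distr (measure_pmf (P n)) borel (\<tau> n)" for n
  have \<nu>_int: "integral\<^sup>L (\<nu> n) g = (\<Sum>i\<in>A n. w n i * g (\<tau> n i))"
    if "g \<in> borel_measurable borel" for n and g :: "real \<Rightarrow> real"
  proof -
    have "integral\<^sup>L (\<nu> n) g = (\<integral>i. g (\<tau> n i) \<partial>measure_pmf (P n))"
      unfolding \<nu>_def by (rule integral_distr) (use that in auto)
    also have "\<dots> = (\<Sum>i\<in>A n. g (\<tau> n i) * pmf (P n) i)"
      by (rule integral_measure_pmf_real) (use fin set_P in auto)
    finally show ?thesis
      by (simp add: pmf_P W_def mult.commute)
  qed
  have rd: "real_distribution (\<nu> n)" for n
    unfolding \<nu>_def by (rule prob_space.real_distribution_distr[OF prob_space_measure_pmf]) auto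
  have "tight \<nu>"
    unfolding tight_def
  proof (intro conjI allI impI rd)
    fix e :: real assume "0 < e"
    have "measure (\<nu> n) {-1<..1} = 1" for n
    proof -
      have "measure (\<nu> n) {-1<..1} = measure (measure_pmf (P n)) (\<tau> n -` {-1<..1})"
        unfolding \<nu>_def by (subst measure_distr) auto
      also have "\<dots> = 1"
        using \<tau>(1) set_P[of n]
        by (subst measure_pmf.prob_eq_1) (fastforce simp: AE_measure_pmf_iff)+
      finally show ?thesis .
    qed
    then show "\<exists>a b. a < b \<and> (\<forall>n. 1 - e < measure (\<nu> n) {a<..b})"
      using \<open>0 < e\<close> by (intro exI[of _ "-1"] exI[of _ 1]) simp
  qed
  from tight_imp_convergent_subsubsequence[OF this strict_mono_id]
  obtain s N where s: "strict_mono s" and N: "real_distribution N"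
    and conv: "weak_conv_m (\<lambda>n. \<nu> (s n)) N"
    by (auto simp: o_def)
  interpret N: real_distribution N by fact
  have cont: "continuous_on UNIV schoenberg_curve"
    unfolding schoenberg_curve_def
    by (intro continuous_on_Pair continuous_schoenberg_coord)
  have meas: "schoenberg_curve \<in> borel_measurable N"
    using borel_measurable_continuous_onI[OF cont] by simp
  define M where "M = distr N borel schoenberg_curve"
  have range: "schoenberg_curve t \<in> {0..1} \<times> {0..1}" for t
    using schoenberg_coord_range by (auto simp: schoenberg_curve_def)
  show ?thesis
  proof (intro exI conjI allI impI)
    show "prob_space M"
      unfolding M_def by (rule N.prob_space_distr[OF meas])
    show "AE p in M. p \<in> {0..1} \<times> {0..1}"
      unfolding M_def
      by (subst AE_distr_iff[OF meas]) (use range in \<open>auto intro!: borel_closed closed_Times\<close>)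
    fix g :: "real \<times> real \<Rightarrow> real" assume g: "continuous_on UNIV g"
    have gc: "continuous_on UNIV (g \<circ> schoenberg_curve)"
      using cont g by (intro continuous_on_compose) (auto intro: continuous_on_subset)
    have "compact (g ` ({0..1} \<times> {0..1}))"
      using g by (intro compact_continuous_image compact_Times compact_Icc) (auto intro: continuous_on_subset)
    then obtain B where B: "\<And>p. p \<in> {0..1} \<times> {0..1} \<Longrightarrow> norm (g p) \<le> B"
      using compact_imp_bounded bounded_iff by (metis image_eqI)
    have "(\<lambda>n. integral\<^sup>L (\<nu> (s n)) (g \<circ> schoenberg_curve)) \<longlonglongrightarrow> integral\<^sup>L N (g \<circ> schoenberg_curve)"
      by (rule weak_conv_imp_integral_bdd_continuous_conv[OF rd N conv, of _ B])
         (use gc B range in \<open>auto simp: continuous_on_eq_continuous_at o_def\<close>)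
    also have "(\<lambda>n. integral\<^sup>L (\<nu> (s n)) (g \<circ> schoenberg_curve))
        = (\<lambda>n. \<Sum>i\<in>A (s n). w (s n) i * g (pt (s n) i))"
      using \<tau>(2) borel_measurable_continuous_onI[OF gc] by (auto simp: \<nu>_int o_def fun_eq_iff intro!: sum.cong)
    also have "integral\<^sup>L N (g \<circ> schoenberg_curve) = (\<integral>p. g p \<partial>M)"
      unfolding M_def o_def
      by (rule integral_distr[symmetric, OF meas]) (rule borel_measurable_continuous_onI[OF g])
    finally show "(\<lambda>n. \<Sum>i\<in>A (s n). w (s n) i * g (pt (s n) i)) \<longlonglongrightarrow> (\<integral>p. g p \<partial>M)" .
  qed (simp_all add: M_def s)
qed

section \<open>The Hausdorff moment problem on the unit square\<close>

text \<open>Both sides are products of \<open>a\<close> factors of modulus at most \<open>1\<close>, namely \<open>(i - q) / (n - q)\<close> for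
\<open>q < a\<close> against \<open>i / n\<close>, and corresponding factors differ by at most \<open>q / (n - q)\<close>. What
matters is that the bound tends to \<open>0\<close> uniformly in \<open>i\<close> as \<open>n\<close> grows.\<close>

lemma choose_ratio_approx:
  fixes n i a :: nat
  assumes "i \<le> n" "2 * a < n"
  shows "\<bar>real (i choose a) / real (n choose a) - (real i / real n) ^ a\<bar> \<le> real a * (real a / real (n - a))"
proof -
  define z where "z q = (real i - real q) / (real n - real q)" for q
  have "real (i choose a) / real (n choose a) = (\<Prod>q<a. z q)"
    by (simp add: binomial_gbinomial gbinomial_prod_rev prod_dividef z_def atLeast0LessThan)
  moreover have "(real i / real n) ^ a = (\<Prod>q<a. real i / real n)"
    by simp
  moreover have "norm ((\<Prod>q<a. z q) - (\<Prod>q<a. real i / real n)) \<le> (\<Sum>q<a. norm (z q - real i / real n))"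
  proof (rule norm_prod_diff)
    fix q assume "q \<in> {..<a}"
    then have q: "2 * q < n" using assms by simp
    then have pos: "0 < real n - real q" by simp
    have "real q \<le> real n - real q" using q by simp
    then have "\<bar>real i - real q\<bar> \<le> real n - real q"
      using assms(1) q by (auto simp: abs_if)
    then show "norm (z q) \<le> 1"
      using pos by (simp add: z_def)
    show "norm (real i / real n) \<le> 1"
      using assms by simp
  qed
  moreover have "(\<Sum>q<a. norm (z q - real i / real n)) \<le> (\<Sum>q<a. real a / real (n - a))"
  proof (rule sum_mono)
    fix q assume "q \<in> {..<a}"
    then have q: "q < a" "q < n" using assms by auto
    have "z q - real i / real n = - (real q / (real n - real q) * ((real n - real i) / real n))"
      using q by (simp add: z_def field_simps)
    then have "norm (z q - real i / real n) = real q / (real n - real q) * ((real n - real i) / real n)"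
      using q assms by (simp add: abs_mult)
    also have "\<dots> \<le> real q / (real n - real q) * 1"
      using q assms by (intro mult_left_mono) auto
    also have "\<dots> \<le> real a / real (n - a)"
      using q assms by (simp add: frac_le of_nat_diff)
    finally show "norm (z q - real i / real n) \<le> real a / real (n - a)" .
  qed
  ultimately show ?thesis
    by simp
qed

lemma binomial_sum_Suc:
  fixes g :: "nat \<Rightarrow> real"
  shows "(\<Sum>i\<le>Suc m. real (Suc m choose i) * g i) = (\<Sum>i\<le>m. real (m choose i) * (g (Suc i) + g i))"
proof -
  have "(\<Sum>i\<le>Suc m. real (Suc m choose i) * g i)
      = (\<Sum>i\<le>m. real (m choose i) * g (Suc i)) + (g 0 + (\<Sum>i\<le>m. real (m choose Suc i) * g (Suc i)))"
    by (simp add: sum.atMost_Suc_shift algebra_simps sum.distrib del: sum.atMost_Suc)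
  also have "g 0 + (\<Sum>i\<le>m. real (m choose Suc i) * g (Suc i)) = (\<Sum>i\<le>Suc m. real (m choose i) * g i)"
    by (simp add: sum.atMost_Suc_shift del: sum.atMost_Suc)
  also have "\<dots> = (\<Sum>i\<le>m. real (m choose i) * g i)"
    by simp
  finally show ?thesis
    by (simp add: algebra_simps sum.distrib)
qed

text \<open>For \<open>d i k = \<integral>t^i (1 - t)^k\<close> the hypothesis is \<open>1 = t + (1 - t)\<close> under the integral, and the
conclusion is the binomial theorem for \<open>1 = (t + (1 - t))^m\<close>.\<close>

lemma pascal_iterate:
  fixes d :: "nat \<Rightarrow> nat \<Rightarrow> real"
  assumes pascal: "\<And>i k. d i k = d (Suc i) k + d i (Suc k)"
  shows "d a k = (\<Sum>i\<le>m. real (m choose i) * d (a + i) (k + (m - i)))"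
proof (induction m)
  case (Suc m)
  have "d (a + i) (k + (m - i)) = d (a + Suc i) (k + (Suc m - Suc i)) + d (a + i) (k + (Suc m - i))"
    if "i \<le> m" for i
    using pascal[of "a + i" "k + (m - i)"] that by (simp add: Suc_diff_le)
  then show ?case
    unfolding binomial_sum_Suc Suc.IH[symmetric]
    by (subst Suc.IH) (auto intro!: sum.cong)
qed simp

text \<open>For \<open>d i k = \<integral>t^i (1 - t)^k\<close> this is the factorial moment of a binomial distribution with random
parameter \<open>t\<close>. The weights \<open>i choose a\<close>, unlike the powers \<open>i ^ a\<close>, reproduce the moment
\<open>d a 0\<close> exactly and not only in the limit.\<close>

lemma binomial_factorial_moment:
  fixes d :: "nat \<Rightarrow> nat \<Rightarrow> real"
  assumes pascal: "\<And>i k. d i k = d (Suc i) k + d i (Suc k)" and "a \<le> n"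
  shows "(\<Sum>i\<le>n. real (n choose i) * d i (n - i) * (real (i choose a) / real (n choose a))) = d a 0"
proof -
  have "(\<Sum>i\<le>n. real (n choose i) * d i (n - i) * (real (i choose a) / real (n choose a)))
      = (\<Sum>i\<in>{a..n}. real (n choose i) * d i (n - i) * (real (i choose a) / real (n choose a)))"
    by (rule sum.mono_neutral_right) auto
  also have "\<dots> = (\<Sum>i\<in>{a..n}. real (n - a choose (i - a)) * d i (n - i))"
  proof (rule sum.cong[OF refl])
    fix i assume i: "i \<in> {a..n}"
    have "real (n choose i) * real (i choose a) = real (n choose a) * real (n - a choose (i - a))"
      using choose_mult[of a i n] i by (simp flip: of_nat_mult)
    moreover have "0 < real (n choose a)"
      using assms(2) by simp
    ultimately show "real (n choose i) * d i (n - i) * (real (i choose a) / real (n choose a))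
        = real (n - a choose (i - a)) * d i (n - i)"
      by (simp add: field_simps)
  qed
  also have "\<dots> = (\<Sum>i\<le>n - a. real (n - a choose i) * d (a + i) (0 + (n - a - i)))"
    by (rule sum.reindex_bij_witness[of _ "\<lambda>i. a + i" "\<lambda>i. i - a"]) (use assms(2) in auto)
  also have "\<dots> = d a 0"
    by (rule pascal_iterate[symmetric]) (rule pascal)
  finally show ?thesis .
qed

text \<open>The number \<open>d i k j l\<close> plays the role of \<open>\<integral>u^i (1 - u)^k v^j (1 - v)^l\<close>, so the two recurrences
express \<open>u + (1 - u) = 1\<close> and \<open>v + (1 - v) = 1\<close>. As in Bernstein's approximation, put the mass
\<open>(n choose i) * (n choose j) * d i (n - i) j (n - j)\<close> at the grid point \<open>(i/n, j/n)\<close>. The weighted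
sums of products of \<open>(i choose a) / (n choose a)\<close> and \<open>(j choose b) / (n choose b)\<close> equal
\<open>d a 0 b 0\<close> exactly, and these ratios approach \<open>(i/n)^a\<close> and \<open>(j/n)^b\<close> uniformly. Hence the moments
of the discrete measures converge to the prescribed ones, and a limit measure has them. Dividing by
the total mass \<open>d 0 0 0 0\<close> turns the discrete measures into probability measures; if it vanishes,
then so do all the moments.\<close>

theorem hausdorff_moment_problem_square:
  fixes d :: "nat \<Rightarrow> nat \<Rightarrow> nat \<Rightarrow> nat \<Rightarrow> real"
  assumes nonneg: "\<And>i k j l. 0 \<le> d i k j l"
    and pascal1: "\<And>i k j l. d i k j l = d (Suc i) k j l + d i (Suc k) j l"
    and pascal2: "\<And>i k j l. d i k j l = d i k (Suc j) l + d i k j (Suc l)"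
  shows "\<exists>M :: (real \<times> real) measure. finite_measure M \<and> sets M = sets borel \<and>
    (AE p in M. p \<in> {0..1} \<times> {0..1}) \<and> (\<forall>a b. (\<integral>p. fst p ^ a * snd p ^ b \<partial>M) = d a 0 b 0)"
proof (cases "d 0 0 0 0 = 0")
  case True
  have "d a 0 b 0 \<le> d 0 0 0 0" for a b
  proof -
    have step1: "d (Suc i) 0 b 0 \<le> d i 0 b 0" for i
      using pascal1[of i 0 b 0] nonneg[of i 1 b 0] by simp
    have step2: "d 0 0 (Suc j) 0 \<le> d 0 0 j 0" for j
      using pascal2[of 0 0 j 0] nonneg[of 0 0 j 1] by simp
    have "d a 0 b 0 \<le> d 0 0 b 0"
      using lift_Suc_antimono_le[of "\<lambda>i. d i 0 b 0", OF step1] by simp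
    also have "\<dots> \<le> d 0 0 0 0"
      using lift_Suc_antimono_le[of "\<lambda>j. d 0 0 j 0", OF step2] by simp
    finally show ?thesis .
  qed
  then have "d a 0 b 0 = 0" for a b
    using True nonneg by (metis order.antisym)
  moreover have "AE p in null_measure borel. p \<in> {0..1} \<times> {0..1::real}"
    by (auto simp: eventually_ae_filter null_sets_def intro!: exI[of _ UNIV])
  ultimately show ?thesis
    by (intro exI[of _ "null_measure borel"]) (auto intro!: finite_measureI)
next
  case False
  define m where "m = d 0 0 0 0"
  have m: "0 < m" using False nonneg[of 0 0 0 0] by (simp add: m_def)
  define A :: "nat \<Rightarrow> (nat \<times> nat) set" where "A n = {..n} \<times> {..n}" for n
  define w where "w n p = (case p of (i, j) \<Rightarrow>
    real (n choose i) * real (n choose j) * d i (n - i) j (n - j) / m)" for n and p :: "nat \<times> nat"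
  define pt where "pt n p = (case p of (i, j) \<Rightarrow> (real i / real n, real j / real n))" for n and p :: "nat \<times> nat"
  define \<phi> where "\<phi> n a i = real (i choose a) / real (n choose a)" for n a i
  have fact_moment: "(\<Sum>p\<in>A n. w n p * (\<phi> n a (fst p) * \<phi> n b (snd p))) = d a 0 b 0 / m"
    if "a \<le> n" "b \<le> n" for a b n
  proof -
    have inner1: "(\<Sum>i\<le>n. real (n choose i) * d i (n - i) j (n - j) * \<phi> n a i) = d a 0 j (n - j)" for j
      unfolding \<phi>_def
      by (rule binomial_factorial_moment[of "\<lambda>i k. d i k j (n - j)"]) (rule pascal1, rule that)
    have inner2: "(\<Sum>j\<le>n. real (n choose j) * d a 0 j (n - j) * \<phi> n b j) = d a 0 b 0"
      unfolding \<phi>_def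
      by (rule binomial_factorial_moment[of "\<lambda>j l. d a 0 j l"]) (rule pascal2, rule that)
    have "(\<Sum>p\<in>A n. w n p * (\<phi> n a (fst p) * \<phi> n b (snd p)))
        = (\<Sum>i\<le>n. \<Sum>j\<le>n. w n (i, j) * (\<phi> n a i * \<phi> n b j))"
      by (simp add: A_def sum.cartesian_product case_prod_unfold)
    also have "\<dots> = (\<Sum>j\<le>n. \<Sum>i\<le>n. w n (i, j) * (\<phi> n a i * \<phi> n b j))"
      by (rule sum.swap)
    also have "\<dots> = (\<Sum>j\<le>n. (\<Sum>i\<le>n. real (n choose i) * d i (n - i) j (n - j) * \<phi> n a i)
        * (real (n choose j) * \<phi> n b j)) / m"
      unfolding sum_divide_distrib sum_distrib_right by (simp add: w_def mult_ac)
    also have "\<dots> = (\<Sum>j\<le>n. real (n choose j) * d a 0 j (n - j) * \<phi> n b j) / m"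
      unfolding inner1 by (simp add: mult_ac)
    also have "\<dots> = d a 0 b 0 / m"
      by (simp only: inner2)
    finally show ?thesis .
  qed
  have w0: "0 \<le> w n p" for n p
    using nonneg m by (auto simp: w_def split: prod.split)
  have mass: "(\<Sum>p\<in>A n. w n p) = 1" for n
    using fact_moment[of 0 n 0] m by (simp add: \<phi>_def m_def)
  have in_square: "pt n p \<in> {0..1} \<times> {0..1}" if "p \<in> A n" for n p
    using that by (auto simp: pt_def A_def divide_le_eq_1)
  obtain M :: "(real \<times> real) measure" and s where M: "prob_space M" "sets M = sets borel"
    and s: "strict_mono s" and M_square: "AE p in M. p \<in> {0..1} \<times> {0..1}"
    and conv: "\<And>g :: real \<times> real \<Rightarrow> real. continuous_on UNIV g \<Longrightarrow>
      (\<lambda>n. \<Sum>p\<in>A (s n). w (s n) p * g (pt (s n) p)) \<longlonglongrightarrow> (\<integral>p. g p \<partial>M)"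
    using discrete_measures_on_square_convergent_subsequence[of A w pt] w0 mass in_square
    by (auto simp: A_def)
  interpret M: prob_space M by fact
  have moment: "(\<integral>p. fst p ^ a * snd p ^ b \<partial>M) = d a 0 b 0 / m" for a b
  proof -
    define S where "S n = (\<Sum>p\<in>A n. w n p * (fst (pt n p) ^ a * snd (pt n p) ^ b))" for n
    define E where "E n = real a * (real a / real (n - a)) + real b * (real b / real (n - b))" for n
    \<comment> \<open>\<open>S n\<close> is the moment of the \<open>n\<close>-th discrete measure; replacing powers by ratios of binomial
        coefficients costs at most \<open>E n\<close>.\<close>
    have bound: "norm (S n - d a 0 b 0 / m) \<le> E n" if n: "2 * (a + b) < n" for n
    proof -
      have term_bound: "\<bar>fst (pt n p) ^ a * snd (pt n p) ^ b - \<phi> n a (fst p) * \<phi> n b (snd p)\<bar> \<le> E n"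
        if p: "p \<in> A n" for p
      proof -
        obtain i j where p_eq: "p = (i, j)" and ij: "i \<le> n" "j \<le> n"
          using p by (auto simp: A_def)
        define x y where "x = real i / real n" and "y = real j / real n"
        have 1: "\<bar>\<phi> n a i - x ^ a\<bar> \<le> real a * (real a / real (n - a))"
          unfolding \<phi>_def x_def using choose_ratio_approx[of i n a] ij n by simp
        have 2: "\<bar>\<phi> n b j - y ^ b\<bar> \<le> real b * (real b / real (n - b))"
          unfolding \<phi>_def y_def using choose_ratio_approx[of j n b] ij n by simp
        have x: "\<bar>x ^ a\<bar> \<le> 1"
          unfolding x_def using ij n by (auto simp: power_le_one)
        have "\<phi> n b j \<le> 1" "0 \<le> \<phi> n b j"
          unfolding \<phi>_def using ij n binomial_right_mono[of j n b] by (auto simp: divide_le_eq_1)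
        then have y: "\<bar>\<phi> n b j\<bar> \<le> 1" by simp
        have "x ^ a * y ^ b - \<phi> n a i * \<phi> n b j = x ^ a * (y ^ b - \<phi> n b j) + (x ^ a - \<phi> n a i) * \<phi> n b j"
          by (simp add: algebra_simps)
        also have "\<bar>\<dots>\<bar> \<le> \<bar>x ^ a * (y ^ b - \<phi> n b j)\<bar> + \<bar>(x ^ a - \<phi> n a i) * \<phi> n b j\<bar>"
          by (rule abs_triangle_ineq)
        also have "\<dots> = \<bar>x ^ a\<bar> * \<bar>\<phi> n b j - y ^ b\<bar> + \<bar>\<phi> n a i - x ^ a\<bar> * \<bar>\<phi> n b j\<bar>"
          by (simp only: abs_mult abs_minus_commute)
        also have "\<dots> \<le> 1 * \<bar>\<phi> n b j - y ^ b\<bar> + \<bar>\<phi> n a i - x ^ a\<bar> * 1"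
          using x y by (intro add_mono mult_mono) auto
        also have "\<dots> \<le> E n"
          using 1 2 by (simp add: E_def)
        finally show ?thesis
          by (simp add: p_eq pt_def x_def y_def)
      qed
      have "S n - d a 0 b 0 / m = (\<Sum>p\<in>A n. w n p *
          (fst (pt n p) ^ a * snd (pt n p) ^ b - \<phi> n a (fst p) * \<phi> n b (snd p)))"
        using fact_moment[of a n b] n by (simp add: S_def right_diff_distrib sum_subtractf)
      also have "norm \<dots> \<le> (\<Sum>p\<in>A n. w n p * E n)"
        using term_bound w0
        by (intro sum_norm_le) (auto simp: abs_mult intro!: mult_left_mono)
      also have "\<dots> = E n"
        using mass by (simp flip: sum_distrib_right)
      finally show ?thesis .
    qed
    have "E \<longlonglongrightarrow> 0"
      unfolding E_def by real_asymp
    then have "(\<lambda>n. S n - d a 0 b 0 / m) \<longlonglongrightarrow> 0"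
      by (rule Lim_null_comparison[rotated])
         (use bound in \<open>auto intro!: eventually_sequentiallyI[of "Suc (2 * (a + b))"]\<close>)
    then have "S \<longlonglongrightarrow> d a 0 b 0 / m"
      by (simp add: LIM_zero_iff)
    then have "(S \<circ> s) \<longlonglongrightarrow> d a 0 b 0 / m"
      using s by (rule LIMSEQ_subseq_LIMSEQ)
    moreover have "(S \<circ> s) \<longlonglongrightarrow> (\<integral>p. fst p ^ a * snd p ^ b \<partial>M)"
      unfolding S_def o_def by (rule conv) (auto intro!: continuous_intros)
    ultimately show ?thesis
      using LIMSEQ_unique by blast
  qed
  show ?thesis
  proof (intro exI[of _ "density M (\<lambda>_. ennreal m)"] conjI allI)
    show "finite_measure (density M (\<lambda>_. ennreal m))"
      by (rule finite_measureI) (simp add: emeasure_density_const M.emeasure_space_1)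
    show "AE p in density M (\<lambda>_. ennreal m). p \<in> {0..1} \<times> {0..1}"
      using M_square by (subst AE_density) auto
    show "(\<integral>p. fst p ^ a * snd p ^ b \<partial>density M (\<lambda>_. ennreal m)) = d a 0 b 0" for a b
      using m moment[of a b] M(2)
      by (subst integral_density) (auto simp: measurable_cong_sets[OF M(2) refl] intro!: borel_measurable_continuous_onI continuous_intros)
  qed (simp add: M)
qed

section \<open>Positive semidefinite functions of controlled growth\<close>

text \<open>A polynomial in \<open>z\<close> and \<open>cnj z\<close> is written as a list of terms, where \<open>(c, (a, b))\<close> stands for
\<open>c * z^a * (cnj z)^b\<close>. The list need not be reduced, so that appending lists adds polynomials and
mapping over them multiplies by monomials.\<close>

type_synonym poly_terms = "(complex \<times> nat \<times> nat) list"

text \<open>Let \<open>L\<close> be the linear functional on such polynomials with \<open>L (z^n * (cnj z)^m) = f (m, n)\<close>. This is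
\<open>L (p * cnj q)\<close> for the polynomials \<open>p\<close> and \<open>q\<close> given by \<open>xs\<close> and \<open>ys\<close>: the swap accounts for the
order of the arguments of \<open>f\<close>.\<close>

definition herm_form :: "(nat \<times> nat \<Rightarrow> complex) \<Rightarrow> poly_terms \<Rightarrow> poly_terms \<Rightarrow> complex" where
  "herm_form f xs ys = (\<Sum>(c, s)\<leftarrow>xs. \<Sum>(d, t)\<leftarrow>ys. c * cnj d * f (prod.swap s + t))"

definition monom_times :: "complex \<Rightarrow> nat \<times> nat \<Rightarrow> poly_terms \<Rightarrow> poly_terms" where
  "monom_times \<alpha> u xs = map (\<lambda>(c, s). (\<alpha> * c, u + s)) xs"

lemma swap_add: "prod.swap (s + t) = prod.swap s + prod.swap (t :: nat \<times> nat)"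
  by (cases s; cases t) simp

lemma swap_0: "prod.swap (0 :: nat \<times> nat) = 0"
  by (simp add: zero_prod_def)

lemma herm_form_Nil: "herm_form f [] ys = 0" "herm_form f xs [] = 0"
  by (induction xs) (auto simp: herm_form_def)

lemma herm_form_append:
  "herm_form f (xs @ xs') ys = herm_form f xs ys + herm_form f xs' ys"
  "herm_form f xs (ys @ ys') = herm_form f xs ys + herm_form f xs ys'"
proof -
  show "herm_form f (xs @ xs') ys = herm_form f xs ys + herm_form f xs' ys"
    by (simp add: herm_form_def)
  show "herm_form f xs (ys @ ys') = herm_form f xs ys + herm_form f xs ys'"
    by (induction xs) (auto simp: herm_form_def algebra_simps)
qed

lemma herm_form_monom_times:
  "herm_form f (monom_times \<alpha> u xs) (monom_times \<beta> v ys)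
    = \<alpha> * cnj \<beta> * herm_form (\<lambda>p. f ((prod.swap u + v) + p)) xs ys"
  by (simp add: herm_form_def monom_times_def sum_list_const_mult[symmetric] o_def
      case_prod_unfold swap_add add_ac mult_ac)

lemma monom_times_1_0: "monom_times 1 0 xs = xs"
  by (induction xs) (auto simp: monom_times_def)

lemma herm_form_add: "herm_form (\<lambda>p. f p + g p) xs ys = herm_form f xs ys + herm_form g xs ys"
  by (simp add: herm_form_def case_prod_unfold sum_list_addf algebra_simps)

lemma herm_form_scale: "herm_form (\<lambda>p. \<alpha> * f p) xs ys = \<alpha> * herm_form f xs ys"
  by (simp add: herm_form_def case_prod_unfold sum_list_const_mult[symmetric] mult_ac)

lemma herm_form_nonneg_if_positive_semidefinite:
  assumes "nat_pairs.positive_semidefinite f"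
  shows "0 \<le> herm_form f xs xs"
proof (cases "xs = []")
  case False
  define N where "N = length xs"
  have N: "N \<ge> 1" using False by (cases xs) (auto simp: N_def)
  define s c where "s j = snd (xs ! (j - 1))" and "c j = fst (xs ! (j - 1))" for j
  have shift: "(\<Sum>j=1..N. g j) = (\<Sum>j<N. g (Suc j))" for g :: "nat \<Rightarrow> complex"
    by (rule sum.reindex_bij_witness[of _ Suc "\<lambda>j. j - 1"]) auto
  have "0 \<le> (\<Sum>j=1..N. \<Sum>k=1..N. c j * cnj (c k) * f (prod.swap (s j) + s k))"
    using assms N unfolding nat_pairs.positive_semidefinite_def by blast
  also have "\<dots> = herm_form f xs xs"
    unfolding shift
    by (simp add: s_def c_def herm_form_def sum_list_sum_nth N_def case_prod_unfold atLeast0LessThan)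
  finally show ?thesis .
qed (simp add: herm_form_Nil)

text \<open>Including \<open>n = 0\<close> in the growth bound only enlarges the constant. The point of this class is that it
is closed under multiplication by the functions that are needed for the Hausdorff conditions.\<close>

definition psd_growth :: "real \<Rightarrow> (nat \<times> nat \<Rightarrow> complex) \<Rightarrow> bool" where
  "psd_growth r f \<longleftrightarrow> (\<forall>xs. 0 \<le> herm_form f xs xs) \<and> (\<exists>C\<ge>0. \<forall>n. Re (f (n, n)) \<le> C * r ^ (2 * n))"

text \<open>By log-convexity the ratios \<open>g (k + 1) / g k\<close> increase, so an initial ratio larger than \<open>q\<close> would force
\<open>g\<close> to grow faster than \<open>q ^ k\<close>.\<close>

lemma log_convex_growth:
  fixes g :: "nat \<Rightarrow> real"
  assumes nonneg: "\<And>k. 0 \<le> g k" and log_convex: "\<And>k. (g (Suc k))\<^sup>2 \<le> g k * g (Suc (Suc k))"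
    and growth: "\<And>k. g k \<le> D * q ^ k" and q: "0 < q"
  shows "g 1 \<le> q * g 0"
proof (rule ccontr)
  assume neg: "\<not> g 1 \<le> q * g 0"
  have g0: "0 < g 0"
    using nonneg[of 0] log_convex[of 0] neg by (cases "g 0 = 0") auto
  define \<rho> where "\<rho> = g 1 / g 0"
  have \<rho>: "q < \<rho>" using neg g0 by (simp add: \<rho>_def field_simps)
  have step: "0 < g k \<and> \<rho> * g k \<le> g (Suc k)" for k
  proof (induction k)
    case 0
    then show ?case using g0 by (simp add: \<rho>_def)
  next
    case (Suc k)
    have pos: "0 < g (Suc k)"
      using Suc \<rho> q by (meson less_le_trans mult_pos_pos order.strict_trans)
    have "g k * (\<rho> * g (Suc k)) \<le> g (Suc k) * g (Suc k)"
      using Suc pos mult_right_mono[of "\<rho> * g k" "g (Suc k)" "g (Suc k)"] by (simp add: mult_ac)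
    also have "\<dots> \<le> g k * g (Suc (Suc k))"
      using log_convex[of k] by (simp add: power2_eq_square)
    finally show ?case
      using Suc pos by simp
  qed
  have "\<rho> ^ k * g 0 \<le> g k" for k
  proof (induction k)
    case (Suc k)
    have "\<rho> ^ Suc k * g 0 \<le> \<rho> * g k"
      using Suc \<rho> q by (simp add: mult.assoc mult_left_mono)
    then show ?case using step[of k] by linarith
  qed simp
  then have "\<rho> ^ k * g 0 \<le> D * q ^ k" for k
    using growth order.trans by blast
  then have bounded: "(\<rho> / q) ^ k \<le> D / g 0" for k
    using g0 q by (simp add: power_divide field_simps)
  moreover obtain k where "D / g 0 < (\<rho> / q) ^ k"
    using real_arch_pow[of "\<rho> / q"] \<rho> q by auto
  ultimately show False
    by (meson not_less)
qed

text \<open>In terms of \<open>L\<close> this is \<open>L ((r^2 - |z|^2) * |p|^2) \<ge> 0\<close>, which is how the growth of the diagonal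
confines the measure to the disc. The numbers \<open>L (|z|^(2k) * |p|^2)\<close> are log-convex in \<open>k\<close>, because
\<open>L (|z|^(2k) * (\<alpha> + \<beta> * |z|^2)^2 * |p|^2) \<ge> 0\<close> for all real \<open>\<alpha>\<close> and \<open>\<beta>\<close>, and they
are \<open>O(r^(2k))\<close>. The latter is the growth hypothesis if \<open>p\<close> is a single term, and it passes to
sums by \<open>|p + q|^2 \<le> 2 * |p|^2 + 2 * |q|^2\<close>, which under \<open>L\<close> follows from the parallelogram law.\<close>

lemma psd_growth_localized:
  assumes f: "psd_growth r f" and r: "0 < r"
  shows "herm_form (\<lambda>p. f ((1, 1) + p)) xs xs \<le> complex_of_real (r\<^sup>2) * herm_form f xs xs"
proof -
  have psd: "0 \<le> herm_form f ys ys" for ys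
    using f by (simp add: psd_growth_def)
  obtain C where C: "C \<ge> 0" "\<And>n. Re (f (n, n)) \<le> C * r ^ (2 * n)"
    using f by (auto simp: psd_growth_def)
  define G where "G k ys = herm_form (\<lambda>p. f ((k, k) + p)) ys ys" for k ys
  have G_nonneg: "0 \<le> G k ys" for k ys
    using psd[of "monom_times 1 (k, 0) ys"]
    by (simp add: herm_form_monom_times G_def)
  have log_convex: "(Re (G (Suc k) ys))\<^sup>2 \<le> Re (G k ys) * Re (G (Suc (Suc k)) ys)" for k ys
  proof -
    let ?g = "\<lambda>k. Re (G k ys)"
    \<comment> \<open>The value of the functional at \<open>|z|^(2k) * (\<alpha> + \<beta> * |z|^2)^2 * |p|^2\<close>.\<close>
    have quad: "0 \<le> \<alpha>\<^sup>2 * ?g k + 2 * \<alpha> * \<beta> * ?g (Suc k) + \<beta>\<^sup>2 * ?g (Suc (Suc k))" for \<alpha> \<beta> :: real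
    proof -
      have "0 \<le> herm_form f (monom_times \<alpha> (k, 0) ys @ monom_times \<beta> (Suc k, 1) ys)
          (monom_times \<alpha> (k, 0) ys @ monom_times \<beta> (Suc k, 1) ys)"
        by (rule psd)
      also have "\<dots> = \<alpha>\<^sup>2 * G k ys + 2 * \<alpha> * \<beta> * G (Suc k) ys + \<beta>\<^sup>2 * G (Suc (Suc k)) ys"
        by (simp add: herm_form_append herm_form_monom_times G_def
            power2_eq_square algebra_simps)
      finally show ?thesis
        by (simp add: less_eq_complex_def flip: of_real_power)
    qed
    \<comment> \<open>The matrix of a nonnegative quadratic form has nonnegative determinant: evaluate the form at
        \<open>(g (k + 2), - g (k + 1))\<close>. If \<open>g (k + 2) = 0\<close>, the form is affine in \<open>\<beta>\<close> for \<open>\<alpha> = 1\<close>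
        and can be nonnegative only if \<open>g (k + 1)\<close> vanishes too.\<close>
    show ?thesis
    proof (cases "?g (Suc (Suc k)) = 0")
      case True
      have lin: "0 \<le> ?g k + 2 * \<beta> * ?g (Suc k)" for \<beta>
        using quad[of 1 \<beta>] True by simp
      have "?g (Suc k) = 0"
      proof (rule ccontr)
        assume nz: "?g (Suc k) \<noteq> 0"
        define \<beta> where "\<beta> = - (?g k + 1) / (2 * ?g (Suc k))"
        have "2 * \<beta> * ?g (Suc k) = - (?g k + 1)"
          using nz by (simp add: \<beta>_def)
        then show False using lin[of \<beta>] by linarith
      qed
      then show ?thesis using True by simp
    next
      case False
      then have pos: "0 < ?g (Suc (Suc k))"
        using G_nonneg[of "Suc (Suc k)" ys] by (simp add: less_eq_complex_def)
      have "0 \<le> ?g (Suc (Suc k)) * (?g k * ?g (Suc (Suc k)) - (?g (Suc k))\<^sup>2)"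
        using quad[of "?g (Suc (Suc k))" "- ?g (Suc k)"] by (simp add: power2_eq_square algebra_simps)
      then show ?thesis
        using pos by (simp add: zero_le_mult_iff)
    qed
  qed
  have growth: "\<exists>D. \<forall>k. Re (G k ys) \<le> D * (r\<^sup>2) ^ k" for ys
  proof (induction ys)
    case Nil
    then show ?case by (intro exI[of _ 0]) (simp add: G_def herm_form_Nil)
  next
    case (Cons x ys)
    then obtain D where D: "\<And>k. Re (G k ys) \<le> D * (r\<^sup>2) ^ k" by blast
    obtain c a b where x: "x = (c, a, b)" by (cases x)
    define E where "E = (cmod c)\<^sup>2 * C * r ^ (2 * (a + b))"
    have "Re (G k (x # ys)) \<le> (2 * E + 2 * D) * (r\<^sup>2) ^ k" for k
    proof -
      \<comment> \<open>The parallelogram law, in which the term for the difference is nonnegative.\<close>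
      have "0 \<le> G k ([x] @ monom_times (-1) 0 ys)"
        by (rule G_nonneg)
      also have "\<dots> = 2 * G k [x] + 2 * G k ys - G k ([x] @ ys)"
        unfolding G_def herm_form_append
        using herm_form_monom_times[of _ 1 0 _ "- 1" 0] herm_form_monom_times[of _ "- 1" 0 _ 1 0]
        by (simp add: herm_form_monom_times monom_times_1_0 swap_0 algebra_simps)
      finally have "Re (G k (x # ys)) \<le> 2 * Re (G k [x]) + 2 * Re (G k ys)"
        by (simp add: less_eq_complex_def)
      moreover have "Re (G k [x]) \<le> E * (r\<^sup>2) ^ k"
      proof -
        have "G k [x] = complex_of_real ((cmod c)\<^sup>2) * f (k + (a + b), k + (a + b))"
          by (simp add: G_def herm_form_def x complex_norm_square[symmetric, simplified] add_ac)
        then have "Re (G k [x]) = (cmod c)\<^sup>2 * Re (f (k + (a + b), k + (a + b)))"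
          by simp
        also have "\<dots> \<le> (cmod c)\<^sup>2 * (C * r ^ (2 * (k + (a + b))))"
          by (intro mult_left_mono C) auto
        also have "r ^ (2 * (k + (a + b))) = r ^ (2 * (a + b)) * (r\<^sup>2) ^ k"
          by (simp add: distrib_left add_ac flip: power_mult power_add)
        finally show ?thesis
          by (simp add: E_def mult_ac)
      qed
      ultimately show ?thesis
        using D[of k] by (simp add: algebra_simps)
    qed
    then show ?case by blast
  qed
  obtain D where D: "\<And>k. Re (G k xs) \<le> D * (r\<^sup>2) ^ k"
    using growth by blast
  have "Re (G 1 xs) \<le> r\<^sup>2 * Re (G 0 xs)"
  proof (rule log_convex_growth[OF _ log_convex D])
    show "0 \<le> Re (G k xs)" for k
      using G_nonneg[of k xs] by (simp add: less_eq_complex_def)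
  qed (use r in simp)
  then have "G 1 xs \<le> r\<^sup>2 * G 0 xs"
    using G_nonneg[of 1 xs] G_nonneg[of 0 xs] by (simp add: less_eq_complex_def flip: of_real_power)
  then show ?thesis
    by (simp add: G_def flip: zero_prod_def)
qed

text \<open>This is multiplication of the functional by \<open>2 * r + \<epsilon> * z + cnj (\<epsilon> * z)\<close>, which for \<open>|\<epsilon>| = 1\<close> is
nonnegative on a half plane that contains the disc and is bounded by one of its tangents. For \<open>\<epsilon>\<close> equal to
\<open>1\<close>, \<open>-1\<close>, \<open>-\<i>\<close>, \<open>\<i>\<close> it is \<open>2 * (r + x)\<close>, \<open>2 * (r - x)\<close>, \<open>2 * (r + y)\<close>,
\<open>2 * (r - y)\<close>: the four half planes that cut out the circumscribed square.\<close>

definition half_plane_times :: "real \<Rightarrow> complex \<Rightarrow> (nat \<times> nat \<Rightarrow> complex) \<Rightarrow> nat \<times> nat \<Rightarrow> complex" where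
  "half_plane_times r \<epsilon> f p = 2 * r * f p + \<epsilon> * f ((0, 1) + p) + cnj \<epsilon> * f ((1, 0) + p)"

lemma half_plane_times_commute:
  "half_plane_times r \<epsilon> (half_plane_times r \<delta> f) = half_plane_times r \<delta> (half_plane_times r \<epsilon> f)"
  by (rule ext) (simp add: half_plane_times_def algebra_simps)

lemma half_plane_times_opposite:
  "half_plane_times r \<epsilon> f p + half_plane_times r (- \<epsilon>) f p = 4 * r * f p"
  by (simp add: half_plane_times_def)

text \<open>The reason is the identity
\<open>r * (2 * r + \<epsilon> * z + cnj (\<epsilon> * z)) = |r + \<epsilon> * z|^2 + (r^2 - |z|^2)\<close>
for \<open>|\<epsilon>| = 1\<close>.\<close>

lemma herm_form_half_plane_times_nonneg:
  assumes f: "psd_growth r f" and r: "0 < r" and \<epsilon>: "cmod \<epsilon> = 1"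
  shows "0 \<le> herm_form (half_plane_times r \<epsilon> f) xs xs"
proof -
  define ys where "ys = monom_times r 0 xs @ monom_times \<epsilon> (1, 0) xs"
  have \<epsilon>': "\<epsilon> * cnj \<epsilon> = 1"
    using \<epsilon> by (simp add: complex_norm_square[symmetric])
  have hp: "half_plane_times r \<epsilon> f = (\<lambda>p. (2 * r * f p + \<epsilon> * f ((0, 1) + p)) + cnj \<epsilon> * f ((1, 0) + p))"
    by (simp add: half_plane_times_def fun_eq_iff)
  let ?H = "\<lambda>u. herm_form (\<lambda>p. f (u + p)) xs xs"
  have "herm_form f ys ys = r * r * herm_form f xs xs + cnj \<epsilon> * r * ?H (1, 0)
      + \<epsilon> * r * ?H (0, 1) + (\<epsilon> * cnj \<epsilon>) * ?H (1, 1)"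
    by (simp add: ys_def herm_form_append herm_form_monom_times swap_0 algebra_simps)
  then have "r * herm_form (half_plane_times r \<epsilon> f) xs xs
      = herm_form f ys ys + (complex_of_real (r\<^sup>2) * herm_form f xs xs - ?H (1, 1))"
    unfolding hp herm_form_add herm_form_scale \<epsilon>' by (simp add: power2_eq_square algebra_simps)
  also have "0 \<le> \<dots>"
    using f psd_growth_localized[OF f r, of xs] by (intro add_nonneg_nonneg) (auto simp: psd_growth_def)
  finally have "0 \<le> r * herm_form (half_plane_times r \<epsilon> f) xs xs" .
  then show ?thesis
    using r by (simp add: less_eq_complex_def zero_le_mult_iff)
qed

text \<open>The growth bound survives because the functionals for \<open>\<epsilon>\<close> and \<open>- \<epsilon>\<close> have nonnegative diagonals
that add up to \<open>4 * r\<close> times the diagonal of \<open>f\<close>.\<close>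

lemma psd_growth_half_plane_times:
  assumes f: "psd_growth r f" and r: "0 < r" and \<epsilon>: "cmod \<epsilon> = 1"
  shows "psd_growth r (half_plane_times r \<epsilon> f)"
  unfolding psd_growth_def
proof (intro conjI allI)
  show "0 \<le> herm_form (half_plane_times r \<epsilon> f) xs xs" for xs
    by (rule herm_form_half_plane_times_nonneg[OF assms])
  obtain C where C: "C \<ge> 0" "\<And>n. Re (f (n, n)) \<le> C * r ^ (2 * n)"
    using f by (auto simp: psd_growth_def)
  show "\<exists>C\<ge>0. \<forall>n. Re (half_plane_times r \<epsilon> f (n, n)) \<le> C * r ^ (2 * n)"
  proof (intro exI[of _ "4 * r * C"] conjI allI)
    fix n
    have "0 \<le> herm_form (half_plane_times r (- \<epsilon>) f) [(1, n, 0)] [(1, n, 0)]"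
      using \<epsilon> by (intro herm_form_half_plane_times_nonneg[OF f r]) simp
    then have "0 \<le> Re (half_plane_times r (- \<epsilon>) f (n, n))"
      by (simp add: herm_form_def less_eq_complex_def)
    moreover have "Re (half_plane_times r \<epsilon> f (n, n)) + Re (half_plane_times r (- \<epsilon>) f (n, n))
        = 4 * r * Re (f (n, n))"
      using arg_cong[OF half_plane_times_opposite[of r \<epsilon> f "(n, n)"], of Re] by simp
    ultimately have "Re (half_plane_times r \<epsilon> f (n, n)) \<le> 4 * r * Re (f (n, n))"
      by linarith
    also have "\<dots> \<le> 4 * r * (C * r ^ (2 * n))"
      using r C by (intro mult_left_mono) auto
    finally show "Re (half_plane_times r \<epsilon> f (n, n)) \<le> 4 * r * C * r ^ (2 * n)"
      by simp
  qed (use r C in simp)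
qed

lemma psd_growth_origin_nonneg:
  assumes "psd_growth r f"
  shows "0 \<le> f (0, 0)"
proof -
  have "0 \<le> herm_form f [(1, 0, 0)] [(1, 0, 0)]"
    using assms by (auto simp: psd_growth_def)
  then show ?thesis by (simp add: herm_form_def)
qed

section \<open>The representing measure on the disc\<close>

text \<open>A set of positive measure on which \<open>h \<ge> \<rho> > q\<close> would contribute at least a multiple of
\<open>\<rho> ^ n\<close> to the \<open>n\<close>-th moment.\<close>

lemma AE_le_if_moments_bounded:
  fixes h :: "'a \<Rightarrow> real"
  assumes M: "finite_measure M" and meas[measurable]: "h \<in> borel_measurable M"
    and nonneg: "\<And>x. x \<in> space M \<Longrightarrow> 0 \<le> h x"
    and int: "\<And>n. integrable M (\<lambda>x. h x ^ n)"
    and bound: "\<And>n. (\<integral>x. h x ^ n \<partial>M) \<le> C * q ^ n" and q: "0 < q"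
  shows "AE x in M. h x \<le> q"
proof -
  interpret finite_measure M by fact
  have null: "measure M {x \<in> space M. \<rho> \<le> h x} = 0" if \<rho>: "q < \<rho>" for \<rho>
  proof (rule ccontr)
    let ?A = "{x \<in> space M. \<rho> \<le> h x}"
    assume "measure M ?A \<noteq> 0"
    then have pos: "0 < measure M ?A"
      using zero_less_measure_iff by blast
    have "(\<rho> / q) ^ n \<le> C / measure M ?A" for n
    proof -
      have "\<rho> ^ n * measure M ?A = (\<integral>x. \<rho> ^ n * indicator ?A x \<partial>M)"
        by simp
      also have "\<dots> \<le> (\<integral>x. h x ^ n \<partial>M)"
      proof (rule integral_mono[OF _ int])
        show "integrable M (\<lambda>x. \<rho> ^ n * indicator ?A x)"
          by (intro integrable_mult_right integrable_real_indicator) (simp_all add: less_top[symmetric])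
      qed (use q \<rho> nonneg in \<open>auto simp: indicator_def intro!: power_mono\<close>)
      also have "\<dots> \<le> C * q ^ n"
        by (rule bound)
      finally show ?thesis
        using q pos by (simp add: power_divide field_simps)
    qed
    moreover obtain n where "C / measure M ?A < (\<rho> / q) ^ n"
      using real_arch_pow[of "\<rho> / q"] \<rho> q by auto
    ultimately show False
      by (meson not_less)
  qed
  have "AE x in M. \<forall>k. h x < q + 1 / real (Suc k)"
    unfolding AE_all_countable
  proof
    fix k
    show "AE x in M. h x < q + 1 / real (Suc k)"
      using null[of "q + 1 / real (Suc k)"]
      by (intro AE_I[of _ _ "{x \<in> space M. q + 1 / real (Suc k) \<le> h x}"])
         (auto simp: emeasure_eq_measure not_less)
  qed
  then show ?thesis
  proof (rule AE_mp, intro AE_I2 impI)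
    fix x assume h: "\<forall>k. h x < q + 1 / real (Suc k)"
    show "h x \<le> q"
    proof (rule field_le_epsilon)
      fix e :: real assume "0 < e"
      then obtain k where "inverse (real (Suc k)) < e"
        using reals_Archimedean by blast
      then show "h x \<le> q + e"
        using h[rule_format, of k] by (simp add: inverse_eq_divide)
    qed
  qed
qed

lemma radon_measure_on_restrict_space:
  fixes M :: "'a::{second_countable_topology, complete_space} measure"
  assumes M: "finite_measure M" "sets M = sets borel" and K: "K \<in> sets borel"
  shows "radon_measure_on K (restrict_space M K)"
proof -
  interpret finite_measure M by fact
  have K_M: "K \<inter> space M \<in> sets M"
    using K M by auto
  have em: "emeasure (restrict_space M K) B = emeasure M B" if "B \<subseteq> K" for B
    using K_M that by (rule emeasure_restrict_space)
  show ?thesis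
    unfolding radon_measure_on_def
  proof (intro conjI allI impI ballI)
    show "sets (restrict_space M K) = sets (restrict_space borel K)"
      by (rule sets_restrict_space_cong) (rule M)
    show "emeasure (restrict_space M K) L < \<infinity>" if "compact L \<and> L \<subseteq> K" for L
      using that by (simp add: em less_top[symmetric])
    fix B assume "B \<in> sets (restrict_space M K)"
    then have B: "B \<in> sets borel" "B \<subseteq> K"
      using K_M M K by (auto simp: sets_restrict_space_iff)
    have "emeasure M B = (SUP L \<in> {L. L \<subseteq> B \<and> compact L}. emeasure M L)"
      by (rule inner_regular) (use B M in auto)
    also have "\<dots> = (SUP L \<in> {L. compact L \<and> L \<subseteq> B}. emeasure (restrict_space M K) L)"
      using B(2) by (intro SUP_cong) (auto simp: em)
    finally show "emeasure (restrict_space M K) B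
        = (SUP L \<in> {L. compact L \<and> L \<subseteq> B}. emeasure (restrict_space M K) L)"
      using B(2) by (simp add: em)
  qed
qed

lemma integrable_continuous_AE_compact:
  fixes g :: "'a::topological_space \<Rightarrow> 'b::{banach, second_countable_topology}"
  assumes M: "finite_measure M" "sets M = sets borel" and AE: "AE x in M. x \<in> K"
    and K: "compact K" and g: "continuous_on UNIV g"
  shows "integrable M g"
proof -
  interpret finite_measure M by fact
  have "bounded (g ` K)"
    using g K by (intro compact_imp_bounded compact_continuous_image) (auto intro: continuous_on_subset)
  then obtain B where "\<And>x. x \<in> K \<Longrightarrow> norm (g x) \<le> B"
    by (auto simp: bounded_iff)
  with AE have "AE x in M. norm (g x) \<le> B"
    by auto
  then show ?thesis
    using borel_measurable_continuous_onI[OF g]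
    by (intro integrable_const_bound) (simp_all add: measurable_cong_sets[OF M(2) refl])
qed

lemma funpow_commute_apply:
  assumes "\<And>x. F (G x) = G (F x)"
  shows "(F ^^ n) (G x) = G ((F ^^ n) x)"
  by (induction n) (simp_all add: assms)

text \<open>The affine map from the unit square onto the square circumscribed about the disc.\<close>

definition square_point :: "real \<Rightarrow> real \<times> real \<Rightarrow> complex" where
  "square_point r p = Complex (2 * r * fst p - r) (2 * r * snd p - r)"

lemma continuous_square_point: "continuous_on S (square_point r)"
  unfolding square_point_def Complex_eq by (intro continuous_intros)

lemma power_mult_cnj_power: "z ^ n * cnj z ^ n = complex_of_real ((cmod z) ^ (2 * n))"
  by (simp only: power_mult of_real_power[of "(cmod z)\<^sup>2" n] complex_norm_square power_mult_distrib)

text \<open>With \<open>u = (x + r) / (2 * r)\<close> and \<open>v = (y + r) / (2 * r)\<close>, the four half-plane multiplications divided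
by \<open>4 * r\<close> multiply the functional by \<open>u\<close>, \<open>1 - u\<close>, \<open>v\<close> and \<open>1 - v\<close>. Their iterates stay in the
class, so their values at the origin are nonnegative and meet the Hausdorff conditions. The
resulting measure has the moments of \<open>f\<close> in \<open>u\<close> and \<open>v\<close>; since \<open>z\<close> and \<open>cnj z\<close> are affine in
\<open>u\<close> and \<open>v\<close>, the moments in \<open>z\<close> and \<open>cnj z\<close> follow by induction on the exponents.\<close>

lemma psd_growth_moments_on_square:
  assumes f: "psd_growth r f" and r: "0 < r"
  shows "\<exists>M :: (real \<times> real) measure. finite_measure M \<and> sets M = sets borel \<and>
    (AE p in M. p \<in> {0..1} \<times> {0..1}) \<and>
    (\<forall>m n. f (m, n) = (\<integral>p. square_point r p ^ n * cnj (square_point r p) ^ m \<partial>M))"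
proof -
  let ?T = "half_plane_times r"
  define F where "F i k j l = (?T 1 ^^ i) ((?T (-1) ^^ k) ((?T (-\<i>) ^^ j) ((?T \<i> ^^ l) f)))" for i k j l
  define d where "d i k j l = Re (F i k j l (0, 0)) / (4 * r) ^ (i + k + j + l)" for i k j l
  have psd_funpow: "psd_growth r ((?T \<epsilon> ^^ n) g)" if "psd_growth r g" "cmod \<epsilon> = 1" for g \<epsilon> n
    by (induction n) (use that psd_growth_half_plane_times[OF _ r] in auto)
  have psd_F: "psd_growth r (F i k j l)" for i k j l
    unfolding F_def by (intro psd_funpow f) simp_all
  have F_Suc: "F (Suc i) k j l = ?T 1 (F i k j l)" "F i (Suc k) j l = ?T (-1) (F i k j l)"
     "F i k (Suc j) l = ?T (-\<i>) (F i k j l)" "F i k j (Suc l) = ?T \<i> (F i k j l)" for i k j l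
    unfolding F_def
    by (simp_all add: funpow_commute_apply[of "?T \<epsilon>" "?T \<delta>" for \<epsilon> \<delta>, OF half_plane_times_commute])
  have split1: "F (Suc i) k j l p + F i (Suc k) j l p = 4 * r * F i k j l p" for i k j l p
    using half_plane_times_opposite[of r 1 "F i k j l" p] by (simp add: F_Suc)
  have split2: "F i k (Suc j) l p + F i k j (Suc l) p = 4 * r * F i k j l p" for i k j l p
    using half_plane_times_opposite[of r "-\<i>" "F i k j l" p] by (simp add: F_Suc)
  have "0 \<le> d i k j l" for i k j l
    using psd_growth_origin_nonneg[OF psd_F, of i k j l] r
    by (simp add: d_def less_eq_complex_def)
  moreover have "d i k j l = d (Suc i) k j l + d i (Suc k) j l" for i k j l
    using arg_cong[OF split1[of i k j l "(0, 0)"], of Re] r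
    by (simp add: d_def add_divide_distrib[symmetric])
  moreover have "d i k j l = d i k (Suc j) l + d i k j (Suc l)" for i k j l
    using arg_cong[OF split2[of i k j l "(0, 0)"], of Re] r
    by (simp add: d_def add_divide_distrib[symmetric])
  ultimately obtain M :: "(real \<times> real) measure" where M: "finite_measure M" "sets M = sets borel"
      "AE p in M. p \<in> {0..1} \<times> {0..1}"
    and moment: "\<And>a b. (\<integral>p. fst p ^ a * snd p ^ b \<partial>M) = d a 0 b 0"
    using hausdorff_moment_problem_square[of d] by blast
  \<comment> \<open>\<open>G a b (m, n)\<close> is the value of the functional, and \<open>Q a b m n\<close> the integrand, for
      \<open>u^a * v^b * z^n * (cnj z)^m\<close>. Carrying \<open>a\<close> and \<open>b\<close> along is what makes the induction work.\<close>
  define G where "G a b = (\<lambda>p. F a 0 b 0 p / (4 * r) ^ (a + b))" for a b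
  define Q where "Q a b m n p = complex_of_real (fst p ^ a * snd p ^ b) * (square_point r p ^ n * cnj (square_point r p) ^ m)" for a b m n p
  have int: "integrable M (Q a b m n)" for a b m n
    unfolding Q_def
    by (rule integrable_continuous_AE_compact[OF M]) (auto intro!: compact_Times continuous_intros continuous_square_point)
  have GT: "?T 1 (G a b) p = 4 * r * G (Suc a) b p" "?T (-\<i>) (G a b) p = 4 * r * G a (Suc b) p" for a b p
    using r by (simp_all add: G_def F_Suc) (simp_all add: half_plane_times_def field_simps)
  have Gz: "G a b (m, Suc n) = (2 * r * G (Suc a) b (m, n) - r * G a b (m, n))
      + \<i> * (2 * r * G a (Suc b) (m, n) - r * G a b (m, n))"
    and Gzb: "G a b (Suc m, n) = (2 * r * G (Suc a) b (m, n) - r * G a b (m, n))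
      - \<i> * (2 * r * G a (Suc b) (m, n) - r * G a b (m, n))" for a b m n
    using GT[of a b "(m, n)"] unfolding half_plane_times_def
    by (simp_all add: algebra_simps complex_eq_iff)
  have Qz: "Q a b m (Suc n) = (\<lambda>p. (2 * r * Q (Suc a) b m n p - r * Q a b m n p)
      + \<i> * (2 * r * Q a (Suc b) m n p - r * Q a b m n p))"
    and Qzb: "Q a b (Suc m) n = (\<lambda>p. (2 * r * Q (Suc a) b m n p - r * Q a b m n p)
      - \<i> * (2 * r * Q a (Suc b) m n p - r * Q a b m n p))" for a b m n
    by (simp_all add: fun_eq_iff Q_def square_point_def Complex_eq algebra_simps)
  have G0: "G a b (0, n) = (\<integral>p. Q a b 0 n p \<partial>M)" for a b n
  proof (induction n arbitrary: a b)
    case 0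
    have "0 \<le> F a 0 b 0 (0, 0)"
      by (rule psd_growth_origin_nonneg[OF psd_F])
    then have "G a b (0, 0) = complex_of_real (d a 0 b 0)"
      by (auto simp: G_def d_def less_eq_complex_def complex_eq_iff)
    also have "\<dots> = (\<integral>p. Q a b 0 0 p \<partial>M)"
      unfolding moment[symmetric] integral_complex_of_real[symmetric] by (simp add: Q_def)
    finally show ?case .
  next
    case (Suc n)
    show ?case
      unfolding Gz Qz Suc.IH using int by simp
  qed
  have G: "G a b (m, n) = (\<integral>p. Q a b m n p \<partial>M)" for a b m n
  proof (induction m arbitrary: a b)
    case 0
    show ?case by (rule G0)
  next
    case (Suc m)
    show ?case
      unfolding Gzb Qzb Suc.IH using int by simp
  qed
  have "f (m, n) = (\<integral>p. square_point r p ^ n * cnj (square_point r p) ^ m \<partial>M)" for m n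
    using G[of 0 0 m n] by (simp add: G_def F_def Q_def)
  with M show ?thesis by blast
qed

text \<open>The measure on the square already has the right moments. Its \<open>n\<close>-th moment of \<open>|z|^2\<close> is
\<open>f (n, n) = O(r^(2n))\<close>, so it gives no mass to the part of the square outside the disc.\<close>

lemma disc_measure_if_psd_growth:
  assumes f: "psd_growth r f" and r: "0 < r"
  shows "\<exists>\<mu> :: complex measure. radon_measure_on {z. (cmod z)\<^sup>2 \<le> r\<^sup>2} \<mu> \<and>
           (\<forall>m n. f (m, n) = (\<integral>z. z ^ n * cnj z ^ m \<partial>\<mu>))"
proof -
  define \<zeta> where "\<zeta> = square_point r"
  define K where "K = {z. (cmod z)\<^sup>2 \<le> r\<^sup>2}"
  from psd_growth_moments_on_square[OF f r]
  obtain M :: "(real \<times> real) measure" where M: "finite_measure M" "sets M = sets borel"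
      "AE p in M. p \<in> {0..1} \<times> {0..1}"
    and moment': "\<forall>m n. f (m, n) = (\<integral>p. square_point r p ^ n * cnj (square_point r p) ^ m \<partial>M)"
    by (elim exE conjE)
  have moment: "f (m, n) = (\<integral>p. \<zeta> p ^ n * cnj (\<zeta> p) ^ m \<partial>M)" for m n
    unfolding \<zeta>_def by (rule moment'[rule_format])
  interpret finite_measure M by fact
  obtain C where C: "\<And>n. Re (f (n, n)) \<le> C * r ^ (2 * n)"
    using f by (auto simp: psd_growth_def)
  have \<zeta>_cont: "continuous_on UNIV \<zeta>"
    unfolding \<zeta>_def by (rule continuous_square_point)
  have \<zeta>_meas: "\<zeta> \<in> borel_measurable M"
    using borel_measurable_continuous_onI[OF \<zeta>_cont] by (simp add: measurable_cong_sets[OF M(2) refl])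
  have in_disc: "AE p in M. (cmod (\<zeta> p))\<^sup>2 \<le> r\<^sup>2"
  proof (rule AE_le_if_moments_bounded[OF M(1), where C = C])
    show "integrable M (\<lambda>p. ((cmod (\<zeta> p))\<^sup>2) ^ n)" for n
      by (rule integrable_continuous_AE_compact[OF M]) (auto intro!: compact_Times continuous_intros \<zeta>_cont)
    show "(\<integral>p. ((cmod (\<zeta> p))\<^sup>2) ^ n \<partial>M) \<le> C * (r\<^sup>2) ^ n" for n
    proof -
      have "f (n, n) = (\<integral>p. complex_of_real (((cmod (\<zeta> p))\<^sup>2) ^ n) \<partial>M)"
        by (simp only: moment power_mult_cnj_power power_mult)
      then have "Re (f (n, n)) = (\<integral>p. ((cmod (\<zeta> p))\<^sup>2) ^ n \<partial>M)"
        by (simp only: integral_complex_of_real Re_complex_of_real)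
      then show ?thesis
        using C[of n] by (simp add: power_mult)
    qed
  qed (use \<zeta>_meas r in auto)
  define N where "N = distr M borel \<zeta>"
  have N: "finite_measure N" "sets N = sets borel"
    unfolding N_def using \<zeta>_meas by (auto intro: finite_measure_distr)
  have K: "K \<in> sets borel"
    unfolding K_def by (intro borel_closed closed_Collect_le continuous_intros)
  have K_N: "AE z in N. z \<in> K"
    unfolding N_def using in_disc K \<zeta>_meas by (subst AE_distr_iff) (auto simp: K_def)
  have "f (m, n) = (\<integral>z. z ^ n * cnj z ^ m \<partial>restrict_space N K)" for m n
  proof -
    have "(\<integral>z. z ^ n * cnj z ^ m \<partial>restrict_space N K)
        = (\<integral>z. indicator K z *\<^sub>R (z ^ n * cnj z ^ m) \<partial>N)"
      by (rule integral_restrict_space) (use K N in auto)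
    also have "\<dots> = (\<integral>z. z ^ n * cnj z ^ m \<partial>N)"
    proof (rule integral_cong_AE)
      show "AE z in N. indicator K z *\<^sub>R (z ^ n * cnj z ^ m) = z ^ n * cnj z ^ m"
        using K_N by eventually_elim simp
      have "(\<lambda>z. z ^ n * cnj z ^ m) \<in> borel_measurable borel"
        by (intro borel_measurable_continuous_onI continuous_intros)
      then show "(\<lambda>z. z ^ n * cnj z ^ m) \<in> borel_measurable N"
          "(\<lambda>z. indicator K z *\<^sub>R (z ^ n * cnj z ^ m)) \<in> borel_measurable N"
        using K N(2)
        by (simp_all only: measurable_cong_sets[OF N(2) refl] borel_measurable_scaleR borel_measurable_indicator)
    qed
    also have "\<dots> = (\<integral>p. \<zeta> p ^ n * cnj (\<zeta> p) ^ m \<partial>M)"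
      unfolding N_def
      by (rule integral_distr[OF \<zeta>_meas]) (auto intro!: borel_measurable_continuous_onI continuous_intros)
    finally show ?thesis
      by (simp add: moment)
  qed
  then show ?thesis
    using radon_measure_on_restrict_space[OF N K] unfolding K_def by blast
qed

section \<open>Moment functions of measures on the disc\<close>

text \<open>The quadratic form of \<open>f\<close> is the integral of \<open>|P|^2\<close> for the polynomial \<open>P\<close> with the given
coefficients. Integrals of bounded functions exist because a measure that is finite on compact
subsets of the closed disc is finite.\<close>

lemma positive_semidefinite_if_disc_measure:
  fixes \<mu> :: "complex measure"
  assumes \<mu>: "radon_measure_on {z. (cmod z)\<^sup>2 \<le> r\<^sup>2} \<mu>" and r: "0 < r"
    and f: "\<And>m n. f (m, n) = (\<integral>z. z ^ n * cnj z ^ m \<partial>\<mu>)"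
  shows "nat_pairs.positive_semidefinite f \<and>
           (\<exists>C::real. C > 0 \<and> (\<forall>n\<ge>1. f (n, n) \<le> complex_of_real (C * r ^ (2 * n))))"
proof -
  define K where "K = {z. (cmod z)\<^sup>2 \<le> r\<^sup>2}"
  have "(cmod z)\<^sup>2 \<le> r\<^sup>2 \<longleftrightarrow> cmod z \<le> r" for z
    using abs_le_square_iff[of "cmod z" r] r by simp
  then have K_cball: "K = cball 0 r"
    by (simp add: K_def cball_def)
  have sets: "sets \<mu> = sets (restrict_space borel K)"
    using \<mu> by (simp add: radon_measure_on_def K_def)
  have space: "space \<mu> = K"
    using sets_eq_imp_space_eq[OF sets] by (simp add: space_restrict_space)
  interpret finite_measure \<mu>
  proof (rule finite_measureI)
    show "emeasure \<mu> (space \<mu>) \<noteq> \<infinity>"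
      using \<mu> compact_cball[of "0::complex" r] unfolding space
      by (auto simp: radon_measure_on_def K_cball[symmetric] K_def[symmetric])
  qed
  have norm_le: "cmod z \<le> r" if "z \<in> K" for z
    using that by (simp add: K_cball)
  have meas: "g \<in> borel_measurable \<mu>" if "continuous_on UNIV g" for g :: "complex \<Rightarrow> complex"
    using borel_measurable_continuous_onI[OF that]
    by (simp add: measurable_cong_sets[OF sets refl] measurable_restrict_space1)
  have int: "integrable \<mu> (\<lambda>z. z ^ n * cnj z ^ m)" for m n
  proof (rule integrable_const_bound)
    show "AE z in \<mu>. norm (z ^ n * cnj z ^ m) \<le> r ^ n * r ^ m"
      using norm_le r
      by (intro AE_I2) (auto simp: space norm_mult norm_power intro!: mult_mono power_mono)
  qed (intro meas continuous_intros)
  show ?thesis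
  proof
    show "nat_pairs.positive_semidefinite f"
      unfolding nat_pairs.positive_semidefinite_def
    proof (intro allI impI)
      fix N :: nat and s :: "nat \<Rightarrow> nat \<times> nat" and c :: "nat \<Rightarrow> complex"
      define P where "P z = (\<Sum>j=1..N. c j * (z ^ fst (s j) * cnj z ^ snd (s j)))" for z
      have "(\<Sum>j=1..N. \<Sum>k=1..N. c j * cnj (c k) * f (prod.swap (s j) + s k))
          = (\<Sum>j=1..N. \<Sum>k=1..N. c j * cnj (c k) *
              (\<integral>z. z ^ (fst (s j) + snd (s k)) * cnj z ^ (snd (s j) + fst (s k)) \<partial>\<mu>))"
        by (simp add: prod.swap_def f case_prod_unfold plus_prod_def)
      also have "\<dots> = (\<integral>z. (\<Sum>j=1..N. \<Sum>k=1..N. c j * cnj (c k) *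
              (z ^ (fst (s j) + snd (s k)) * cnj z ^ (snd (s j) + fst (s k)))) \<partial>\<mu>)"
        using int by (simp add: Bochner_Integration.integral_sum)
      also have "\<dots> = (\<integral>z. complex_of_real ((cmod (P z))\<^sup>2) \<partial>\<mu>)"
        unfolding complex_norm_square P_def cnj_sum sum_product
        by (intro Bochner_Integration.integral_cong refl sum.cong) (simp add: power_add mult_ac)
      also have "\<dots> = complex_of_real (\<integral>z. (cmod (P z))\<^sup>2 \<partial>\<mu>)"
        by (rule integral_complex_of_real)
      finally show "0 \<le> (\<Sum>j=1..N. \<Sum>k=1..N. c j * cnj (c k) * f (prod.swap (s j) + s k))"
        by (simp add: less_eq_complex_def)
    qed
    show "\<exists>C::real. C > 0 \<and> (\<forall>n\<ge>1. f (n, n) \<le> complex_of_real (C * r ^ (2 * n)))"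
    proof (intro exI[of _ "measure \<mu> (space \<mu>) + 1"] conjI allI impI)
      fix n :: nat
      have "f (n, n) = (\<integral>z. complex_of_real (cmod z ^ (2 * n)) \<partial>\<mu>)"
        by (simp only: f power_mult_cnj_power)
      then have fn: "f (n, n) = complex_of_real (\<integral>z. cmod z ^ (2 * n) \<partial>\<mu>)"
        by (simp only: integral_complex_of_real)
      have "(\<integral>z. cmod z ^ (2 * n) \<partial>\<mu>) \<le> (\<integral>z. r ^ (2 * n) \<partial>\<mu>)"
      proof (rule integral_mono)
        show "integrable \<mu> (\<lambda>z. cmod z ^ (2 * n))"
          using integrable_norm[OF int[of n n]] by (simp add: norm_mult norm_power mult_2 power_add)
      qed (use norm_le in \<open>auto simp: space intro!: power_mono\<close>)
      also have "\<dots> \<le> (measure \<mu> (space \<mu>) + 1) * r ^ (2 * n)"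
        using r by (simp add: distrib_right)
      finally show "f (n, n) \<le> complex_of_real ((measure \<mu> (space \<mu>) + 1) * r ^ (2 * n))"
        unfolding fn by (simp add: less_eq_complex_def)
    qed (simp add: add_nonneg_pos)
  qed
qed

theorem theorem5p5:
  fixes f :: "nat \<times> nat \<Rightarrow> complex" and r :: real
  assumes "r > 0"
  shows "(nat_pairs.positive_semidefinite f \<and>
           (\<exists>C::real. C > 0 \<and> (\<forall>n\<ge>1. f (n, n) \<le> complex_of_real (C * r ^ (2 * n)))))
     \<longleftrightarrow>
         (\<exists>\<mu> :: complex measure. radon_measure_on {z. (cmod z)\<^sup>2 \<le> r\<^sup>2} \<mu> \<and>
           (\<forall>m n. f (m, n) = (\<integral>z. z ^ n * cnj z ^ m \<partial>\<mu>)))"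
proof
  assume "nat_pairs.positive_semidefinite f \<and>
    (\<exists>C::real. C > 0 \<and> (\<forall>n\<ge>1. f (n, n) \<le> complex_of_real (C * r ^ (2 * n))))"
  then obtain C where psd: "nat_pairs.positive_semidefinite f" and C: "C > 0"
      "\<And>n. n \<ge> 1 \<Longrightarrow> f (n, n) \<le> complex_of_real (C * r ^ (2 * n))"
    by blast
  have "Re (f (n, n)) \<le> (C + \<bar>Re (f (0, 0))\<bar>) * r ^ (2 * n)" for n
  proof (cases "n = 0")
    case False
    then have "Re (f (n, n)) \<le> C * r ^ (2 * n)"
      using C(2)[of n] by (simp add: less_eq_complex_def)
    also have "\<dots> \<le> (C + \<bar>Re (f (0, 0))\<bar>) * r ^ (2 * n)"
      using assms by (intro mult_right_mono) auto
    finally show ?thesis .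
  qed (use C(1) in auto)
  then have "psd_growth r f"
    unfolding psd_growth_def using C(1) herm_form_nonneg_if_positive_semidefinite[OF psd]
    by (auto intro!: exI[of _ "C + \<bar>Re (f (0, 0))\<bar>"])
  then show "\<exists>\<mu> :: complex measure. radon_measure_on {z. (cmod z)\<^sup>2 \<le> r\<^sup>2} \<mu> \<and>
      (\<forall>m n. f (m, n) = (\<integral>z. z ^ n * cnj z ^ m \<partial>\<mu>))"
    using assms by (rule disc_measure_if_psd_growth)
qed (use positive_semidefinite_if_disc_measure[OF _ assms] in blast)

end
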